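(* For each real $\epsilon>0$, the simple degree sequence region $\mathbb D[\varphi_\epsilon]$ is almost fully graphic, where $\varphi_\epsilon(n,\Sigma,c_1,c_2)$ is the property "$2\le c_2$ and $3\le c_1\le\sqrt{(1-\epsilon)\Sigma}$".
   Context: For natural numbers $n>c_1\ge c_2$ and $\Sigma$, $\mathcal D(n,\Sigma,c_1,c_2)$ is the set of integer sequences $(d_1,\dots,d_n)$ with $c_1\ge d_1\ge\dots\ge d_n\ge c_2$, $\sum_i d_i$ even and $\sum_i d_i=\Sigma$. For a property $\varphi$, the simple region $\mathbb D[\varphi]$ is the union of all $\mathcal D(n,\Sigma,c_1,c_2)$ over $n>c_1\ge c_2$ (and $\Sigma$) with $\varphi(n,\Sigma,c_1,c_2)$ true. A region is fully graphic if every sequence in it is graphic (the degree sequence of a simple graph on labelled vertices), and almost fully graphic if it becomes fully graphic after removing finitely many sequences. *)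

theory Defs
  imports Complex_Main
begin

text \<open>Simple graphs: an edge is a two-element set of vertices, so loops and parallel edges cannot
  occur.\<close>

definition simple_graph :: "'a set \<Rightarrow> 'a set set \<Rightarrow> bool" where
  "simple_graph V E \<longleftrightarrow> finite V \<and> (\<forall>e\<in>E. e \<subseteq> V \<and> card e = 2)"

definition degree :: "'a set set \<Rightarrow> 'a \<Rightarrow> nat" where
  "degree E v = card {e \<in> E. v \<in> e}"

text \<open>A sequence \<open>(d\<^sub>1, \<dots>, d\<^sub>n)\<close> is a list of length \<open>n\<close>; the labelled vertices are the
  list positions \<open>0, \<dots>, n - 1\<close>.\<close>

definition graphic :: "int list \<Rightarrow> bool" where
  "graphic d \<longleftrightarrow>
     (\<exists>E. simple_graph {..<length d} E \<and> (\<forall>i<length d. d ! i = int (degree E i)))"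

definition degree_seqs :: "nat \<Rightarrow> nat \<Rightarrow> nat \<Rightarrow> nat \<Rightarrow> int list set" where
  "degree_seqs n S c1 c2 =
     {d. length d = n \<and> sorted_wrt (\<ge>) d \<and> (\<forall>x\<in>set d. int c2 \<le> x \<and> x \<le> int c1) \<and>
         even (sum_list d) \<and> sum_list d = int S}"

definition simple_region :: "(nat \<Rightarrow> nat \<Rightarrow> nat \<Rightarrow> nat \<Rightarrow> bool) \<Rightarrow> int list set" where
  "simple_region \<phi> =
     \<Union> {degree_seqs n S c1 c2 | n S c1 c2. n > c1 \<and> c1 \<ge> c2 \<and> \<phi> n S c1 c2}"

definition fully_graphic :: "int list set \<Rightarrow> bool" where
  "fully_graphic R \<longleftrightarrow> (\<forall>d\<in>R. graphic d)"

definition almost_fully_graphic :: "int list set \<Rightarrow> bool" where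
  "almost_fully_graphic R \<longleftrightarrow> (\<exists>F. finite F \<and> fully_graphic (R - F))"

text \<open>For \<open>\<epsilon> > 1\<close> the radicand \<open>(1 - \<epsilon>) \<Sigma>\<close> may be negative; then \<open>sqrt\<close> is
  negative in HOL, so the bound \<open>3 \<le> c\<^sub>1 \<le> sqrt ((1 - \<epsilon>) \<Sigma>)\<close> fails, as it should.\<close>

definition phi :: "real \<Rightarrow> nat \<Rightarrow> nat \<Rightarrow> nat \<Rightarrow> nat \<Rightarrow> bool" where
  "phi \<epsilon> n S c1 c2 \<longleftrightarrow> 2 \<le> c2 \<and> 3 \<le> c1 \<and> real c1 \<le> sqrt ((1 - \<epsilon>) * real S)"

end

theory Submission
  imports Defs
begin

text \<open>A sequence of non-negative integers bounded by \<open>c\<close> with even sum \<open>\<Sigma> \<ge> c (c + 1)\<close> is graphic.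
  Moving a unit from a vertex to one of smaller degree preserves realizability, so it suffices to
  realize the extremal case in which at most one entry is strictly between \<open>0\<close> and \<open>c\<close>. There one
  starts from a complete graph on \<open>c + 1\<close> vertices and raises the sum by two at a time, replacing an
  edge \<open>xy\<close> by \<open>ax\<close> and \<open>by\<close>. Finally \<open>c\<^sub>1\<^sup>2 \<le> (1 - \<epsilon>) \<Sigma>\<close> gives \<open>c\<^sub>1 (c\<^sub>1 + 1) \<le> \<Sigma>\<close> as soon as
  \<open>\<Sigma> \<ge> 1 / \<epsilon>\<^sup>2\<close>, and only finitely many sequences with positive entries have smaller sum.\<close>

section \<open>Realizations, neighbourhoods and degrees\<close>

definition realizes :: "'a set \<Rightarrow> ('a \<Rightarrow> nat) \<Rightarrow> 'a set set \<Rightarrow> bool" where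
  "realizes V f E \<longleftrightarrow> simple_graph V E \<and> (\<forall>v\<in>V. degree E v = f v)"

definition nbrs :: "'a set set \<Rightarrow> 'a \<Rightarrow> 'a set" where
  "nbrs E v = {w. {v, w} \<in> E}"

lemma simple_graph_finite: "simple_graph V E \<Longrightarrow> finite E"
  unfolding simple_graph_def by (meson Pow_iff finite_Pow_iff finite_subset subsetI)

lemma simple_graph_edgeD:
  assumes "simple_graph V E" "{v, w} \<in> E"
  shows "v \<in> V" "w \<in> V" "v \<noteq> w"
  using assms unfolding simple_graph_def by (fastforce simp: card_insert_if)+

lemma nbrs_subset:
  assumes "simple_graph V E"
  shows "nbrs E v \<subseteq> V - {v}"
  using simple_graph_edgeD(2,3)[OF assms, of v] by (auto simp: nbrs_def)

lemma finite_nbrs: "simple_graph V E \<Longrightarrow> finite (nbrs E v)"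
  by (meson finite_Diff finite_subset nbrs_subset simple_graph_def)

text \<open>Reading degrees as sizes of neighbourhoods lets degree inequalities produce non-adjacent
  vertices by comparing sets.\<close>

lemma card_nbrs:
  assumes "simple_graph V E"
  shows "card (nbrs E v) = degree E v"
  unfolding degree_def
proof (rule bij_betw_same_card[of "\<lambda>w. {v, w}"], rule bij_betwI')
  fix e assume e: "e \<in> {e \<in> E. v \<in> e}"
  then have "card e = 2" using assms by (auto simp: simple_graph_def)
  then obtain x y where "e = {x, y}" by (auto simp: card_2_iff)
  with e have "e = {v, x} \<or> e = {v, y}" by auto
  with e show "\<exists>w\<in>nbrs E v. e = {v, w}" by (auto simp: nbrs_def)
qed (auto simp: nbrs_def doubleton_eq_iff)

lemma degree_insert:
  assumes "finite E" "e \<notin> E"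
  shows "degree (insert e E) v = degree E v + of_bool (v \<in> e)"
proof -
  have "{e' \<in> insert e E. v \<in> e'} =
      (if v \<in> e then insert e {e' \<in> E. v \<in> e'} else {e' \<in> E. v \<in> e'})"
    by auto
  with assms show ?thesis by (simp add: degree_def)
qed

lemma degree_remove:
  assumes "finite E" "e \<in> E"
  shows "degree E v = degree (E - {e}) v + of_bool (v \<in> e)"
  using degree_insert[of "E - {e}" e v] assms by (simp add: insert_absorb)

lemma simple_graph_insert:
  "simple_graph V E \<Longrightarrow> a \<in> V \<Longrightarrow> b \<in> V \<Longrightarrow> a \<noteq> b \<Longrightarrow> simple_graph V (insert {a, b} E)"
  by (auto simp: simple_graph_def)

lemma simple_graph_remove: "simple_graph V E \<Longrightarrow> simple_graph V (E - D)"
  by (auto simp: simple_graph_def)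

section \<open>Edge exchanges\<close>

text \<open>As \<open>i\<close> has more neighbours than \<open>j\<close>, some neighbour
  \<open>x\<close> of \<open>i\<close> is neither \<open>j\<close> nor adjacent to \<open>j\<close>;
  the edge \<open>ix\<close> is replaced by \<open>jx\<close>.\<close>

lemma realizes_unit_transfer:
  assumes E: "realizes V g E" and V: "i \<in> V" "j \<in> V" and ij: "g j < g i"
  shows "\<exists>E'. realizes V (g(i := g i - 1, j := g j + 1)) E'"
proof -
  have sg: "simple_graph V E" and deg: "\<And>v. v \<in> V \<Longrightarrow> degree E v = g v"
    using E by (auto simp: realizes_def)
  note fin = simple_graph_finite[OF sg]
  have "i \<noteq> j" using ij by auto
  have "\<not> nbrs E i - {j} \<subseteq> nbrs E j - {i}"
  proof
    assume "nbrs E i - {j} \<subseteq> nbrs E j - {i}"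
    then have "card (nbrs E i - {j}) \<le> card (nbrs E j - {i})"
      by (simp add: card_mono finite_nbrs[OF sg])
    moreover have "j \<in> nbrs E i \<longleftrightarrow> i \<in> nbrs E j"
      by (simp add: nbrs_def insert_commute)
    moreover have "card (nbrs E j) < card (nbrs E i)"
      using card_nbrs[OF sg] deg V ij by simp
    \<comment> \<open>If \<open>i\<close> and \<open>j\<close> are adjacent, both cardinalities drop
      by one; positivity keeps the truncated \<open>- 1\<close> from hiding the strict
      inequality.\<close>
    moreover have "0 < card (nbrs E j)" if "i \<in> nbrs E j"
      using that finite_nbrs[OF sg] by (auto simp: card_gt_0_iff)
    ultimately show False by (auto simp: card_Diff_singleton_if split: if_splits)
  qed
  then obtain x where x: "{i, x} \<in> E" "x \<noteq> j" "{j, x} \<notin> E"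
    using simple_graph_edgeD(3)[OF sg] by (auto simp: nbrs_def)
  have xV: "x \<in> V" "x \<noteq> i" using simple_graph_edgeD[OF sg x(1)] by auto
  let ?E = "insert {j, x} (E - {{i, x}})"
  have "simple_graph V ?E"
    using simple_graph_insert simple_graph_remove sg V x xV by metis
  moreover have "degree ?E v = (g(i := g i - 1, j := g j + 1)) v" if "v \<in> V" for v
    using degree_insert[of "E - {{i, x}}" "{j, x}" v] degree_remove[OF fin x(1), of v]
      deg[OF that] fin x xV \<open>i \<noteq> j\<close> by (auto simp: of_bool_def split: if_splits)
  ultimately show ?thesis unfolding realizes_def by blast
qed

text \<open>Replacing \<open>xy\<close> by \<open>ax\<close> and \<open>by\<close> leaves
  \<open>x\<close> and \<open>y\<close> balanced. The case \<open>a = b\<close> is allowed and gives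
  that vertex two units.\<close>

lemma realizes_reroute_edge:
  assumes E: "realizes V g E" and V: "a \<in> V" "b \<in> V"
    and xy: "{x, y} \<in> E" "{a, x} \<notin> E" "{b, y} \<notin> E" "a \<noteq> x" "b \<noteq> y"
  shows "\<exists>E'. realizes V (\<lambda>v. g v + of_bool (v = a) + of_bool (v = b)) E'"
proof -
  have sg: "simple_graph V E" and deg: "\<And>v. v \<in> V \<Longrightarrow> degree E v = g v"
    using E by (auto simp: realizes_def)
  note fin = simple_graph_finite[OF sg]
  have xyV: "x \<in> V" "y \<in> V" "x \<noteq> y" using simple_graph_edgeD[OF sg xy(1)] by auto
  \<comment> \<open>Otherwise \<open>{a, x}\<close> would be the edge \<open>{x, y}\<close>.
    Together with \<open>x \<noteq> y\<close> this keeps the two new edges distinct, even when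
    \<open>a = b\<close>.\<close>
  have ne: "a \<noteq> y" using xy by (auto simp: insert_commute)
  let ?D = "E - {{x, y}}" let ?F = "insert {a, x} ?D"
  have "simple_graph V (insert {b, y} ?F)"
    using simple_graph_insert simple_graph_remove sg V xy xyV by metis
  moreover have "degree (insert {b, y} ?F) v = g v + of_bool (v = a) + of_bool (v = b)"
    if "v \<in> V" for v
  proof -
    have "{b, y} \<notin> ?F" using xy ne xyV by (auto simp: doubleton_eq_iff)
    then have "degree (insert {b, y} ?F) v = degree ?F v + of_bool (v \<in> {b, y})"
      using fin by (intro degree_insert) auto
    moreover have "degree ?F v = degree ?D v + of_bool (v \<in> {a, x})"
      using fin xy by (intro degree_insert) auto
    moreover have "g v = degree ?D v + of_bool (v \<in> {x, y})"
      using degree_remove[OF fin xy(1), of v] deg[OF that] by simp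
    ultimately show ?thesis using xy xyV ne by (auto simp: of_bool_def)
  qed
  ultimately show ?thesis unfolding realizes_def by blast
qed

section \<open>Extremal degree functions\<close>

text \<open>These are the functions bounded by \<open>c\<close> that cannot be made more unequal: no
  unit can move from a positive entry to another entry that is at least as large and still below
  \<open>c\<close>.\<close>

definition extremal :: "'a set \<Rightarrow> nat \<Rightarrow> ('a \<Rightarrow> nat) \<Rightarrow> bool" where
  "extremal V c f \<longleftrightarrow> (\<forall>v\<in>V. f v \<le> c) \<and>
     (\<forall>i\<in>V. \<forall>j\<in>V. 0 < f i \<and> f i < c \<and> 0 < f j \<and> f j < c \<longrightarrow> i = j)"

lemma extremalI:
  assumes "\<And>v. v \<in> V \<Longrightarrow> f v \<le> c" and "\<And>v. v \<in> V \<Longrightarrow> v \<noteq> z \<Longrightarrow> f v = 0 \<or> f v = c"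
  shows "extremal V c f"
proof -
  have "v = z" if "v \<in> V" "0 < f v" "f v < c" for v using assms(2)[of v] that by auto
  then show ?thesis using assms(1) unfolding extremal_def by blast
qed

lemma extremal_sum:
  assumes "finite V" "z \<in> V" and "\<And>v. v \<in> V \<Longrightarrow> v \<noteq> z \<Longrightarrow> f v = 0 \<or> f v = c"
  shows "sum f V = f z + c * card {v \<in> V. v \<noteq> z \<and> f v = c}"
proof -
  have "sum f V = f z + sum f (V - {z})" using assms by (simp add: sum.remove)
  also have "sum f (V - {z}) = (\<Sum>v\<in>V - {z}. if f v = c then c else 0)"
    using assms(3) by (intro sum.cong) auto
  also have "\<dots> = (\<Sum>v\<in>{v \<in> V - {z}. f v = c}. c)"
    using assms(1) by (simp add: sum.If_cases Int_def)
  also have "{v \<in> V - {z}. f v = c} = {v \<in> V. v \<noteq> z \<and> f v = c}" by auto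
  finally show ?thesis by simp
qed

lemma exists_non_neighbour:
  assumes "simple_graph V E" "finite V" "degree E z < card {v \<in> V. v \<noteq> z \<and> f v = c}"
  shows "\<exists>x\<in>V. x \<noteq> z \<and> f x = c \<and> {z, x} \<notin> E"
proof (rule ccontr)
  assume "\<not> ?thesis"
  then have "{v \<in> V. v \<noteq> z \<and> f v = c} \<subseteq> nbrs E z" by (auto simp: nbrs_def)
  then show False using card_mono[OF finite_nbrs[OF assms(1)]] card_nbrs[OF assms(1)] assms(3)
    by (metis not_le)
qed

text \<open>More than \<open>c\<close> full vertices leave one, \<open>x\<close>, not adjacent to
  \<open>z\<close>. It has more neighbours than \<open>z\<close>, so one of them, \<open>y\<close>,
  is not adjacent to \<open>z\<close> either; \<open>xy\<close> is rerouted to \<open>zx\<close> and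
  \<open>zy\<close>.\<close>

lemma realizes_raise_vertex:
  assumes E: "realizes V g E" and z: "z \<in> V" "g z < c"
    and many: "c < card {v \<in> V. v \<noteq> z \<and> g v = c}"
  shows "\<exists>E'. realizes V (g(z := g z + 2)) E'"
proof -
  have sg: "simple_graph V E" and deg: "\<And>v. v \<in> V \<Longrightarrow> degree E v = g v"
    using E by (auto simp: realizes_def)
  have fV: "finite V" using sg by (simp add: simple_graph_def)
  obtain x where x: "x \<in> V" "x \<noteq> z" "g x = c" "{z, x} \<notin> E"
    using exists_non_neighbour[OF sg fV, of z g c] many z deg by force
  have "\<not> nbrs E x \<subseteq> nbrs E z"
    using card_mono[OF finite_nbrs[OF sg], of "nbrs E x" z] card_nbrs[OF sg] x z deg by force
  then obtain y where y: "{x, y} \<in> E" "{z, y} \<notin> E" by (auto simp: nbrs_def)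
  have "z \<noteq> y" using x y by (auto simp: insert_commute)
  then obtain E' where "realizes V (\<lambda>v. g v + of_bool (v = z) + of_bool (v = z)) E'"
    using realizes_reroute_edge[OF E z(1) z(1) y(1) x(4) y(2)] x by auto
  moreover have "(\<lambda>v. g v + of_bool (v = z) + of_bool (v = z)) = g(z := g z + 2)" by auto
  ultimately show ?thesis by metis
qed

text \<open>Again some full \<open>x\<close> is not adjacent to \<open>z\<close>. Since
  \<open>w\<close> is isolated, any neighbour \<open>y\<close> of \<open>x\<close> will do:
  \<open>xy\<close> is rerouted to \<open>zx\<close> and \<open>wy\<close>.\<close>

lemma realizes_raise_two:
  assumes E: "realizes V g E" and z: "z \<in> V" "g z < c" and w: "w \<in> V" "w \<noteq> z" "g w = 0"
    and many: "c < card {v \<in> V. v \<noteq> z \<and> g v = c}"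
  shows "\<exists>E'. realizes V (g(z := g z + 1, w := 1)) E'"
proof -
  have sg: "simple_graph V E" and deg: "\<And>v. v \<in> V \<Longrightarrow> degree E v = g v"
    using E by (auto simp: realizes_def)
  have fV: "finite V" using sg by (simp add: simple_graph_def)
  obtain x where x: "x \<in> V" "x \<noteq> z" "g x = c" "{z, x} \<notin> E"
    using exists_non_neighbour[OF sg fV, of z g c] many z deg by force
  have "nbrs E x \<noteq> {}" using card_nbrs[OF sg, of x] x z deg by force
  then obtain y where y: "{x, y} \<in> E" by (auto simp: nbrs_def)
  have "nbrs E w = {}" using card_nbrs[OF sg, of w] w deg finite_nbrs[OF sg] by force
  then have iso: "{w, v} \<notin> E" for v by (auto simp: nbrs_def)
  have "w \<noteq> y" using y iso by (auto simp: insert_commute)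
  then obtain E' where "realizes V (\<lambda>v. g v + of_bool (v = z) + of_bool (v = w)) E'"
    using realizes_reroute_edge[OF E z(1) w(1) y x(4) iso] x by auto
  moreover have "(\<lambda>v. g v + of_bool (v = z) + of_bool (v = w)) = g(z := g z + 1, w := 1)"
    using w by auto
  ultimately show ?thesis by metis
qed

lemma realizes_complete:
  assumes V: "finite V" "U \<subseteq> V" and U: "card U = c + 1"
    and f: "\<And>v. v \<in> V \<Longrightarrow> f v = (if v \<in> U then c else 0)"
  shows "\<exists>E. realizes V f E"
proof -
  let ?E = "{e. e \<subseteq> U \<and> card e = 2}"
  have sg: "simple_graph V ?E" using V by (auto simp: simple_graph_def)
  have "degree ?E v = f v" if "v \<in> V" for v
  proof -
    have "nbrs ?E v = (if v \<in> U then U - {v} else {})"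
      by (auto simp: nbrs_def card_insert_if)
    then show ?thesis using card_nbrs[OF sg, of v] f[OF that] U by auto
  qed
  with sg show ?thesis by (auto simp: realizes_def)
qed

lemma sum_fun_upd:
  fixes f :: "'a \<Rightarrow> nat"
  assumes "finite V" "z \<in> V"
  shows "sum (f(z := a)) V + f z = sum f V + a"
proof -
  have "sum (f(z := a)) (V - {z}) = sum f (V - {z})" by (intro sum.cong) auto
  then show ?thesis using assms by (simp add: sum.remove)
qed

text \<open>Induction on the sum in steps of two: two units are removed so that the function stays
  extremal, and a raising lemma puts them back.\<close>

lemma realizes_extremal:
  assumes V: "finite V" and c: "0 < c"
  shows "extremal V c f \<Longrightarrow> even (sum f V) \<Longrightarrow> c * (c + 1) \<le> sum f V \<Longrightarrow> \<exists>E. realizes V f E"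
proof (induction "sum f V" arbitrary: f rule: less_induct)
  case less
  note ext = less.prems(1)
  have le: "f v \<le> c" if "v \<in> V" for v using ext that by (auto simp: extremal_def)
  \<comment> \<open>The vertex \<open>z\<close> is the intermediate one if it exists, and otherwise
    any positive vertex, which is then full.\<close>
  have "\<exists>z\<in>V. 0 < f z \<and> (\<forall>v\<in>V. v \<noteq> z \<longrightarrow> f v = 0 \<or> f v = c)"
  proof (cases "\<exists>z\<in>V. 0 < f z \<and> f z < c")
    case True
    then show ?thesis using ext unfolding extremal_def by (metis gr0I le_neq_implies_less)
  next
    case False
    moreover have "\<exists>z\<in>V. 0 < f z"
      using less.prems(3) c by (metis add_is_0 bot_nat_0.not_eq_extremum le_zero_eq mult_is_0 one_neq_zero sum.neutral)
    ultimately show ?thesis using le by (metis gr0I le_neq_implies_less)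
  qed
  then obtain z where z: "z \<in> V" "0 < f z"
    and others: "\<And>v. v \<in> V \<Longrightarrow> v \<noteq> z \<Longrightarrow> f v = 0 \<or> f v = c" by blast
  define q where "q = card {v \<in> V. v \<noteq> z \<and> f v = c}"
  have sum: "sum f V = f z + c * q"
    unfolding q_def by (rule extremal_sum[OF V z(1) others])
  consider (base) "sum f V = c * (c + 1)" | (step) "c * (c + 1) + 2 \<le> sum f V"
  proof -
    have "even (c * (c + 1))" by simp
    then show ?thesis using that less.prems(2,3)
      by (metis One_nat_def Suc_leI add_2_eq_Suc' even_Suc le_neq_implies_less)
  qed
  then show ?case
  proof cases
    case base
    \<comment> \<open>Divisibility forces \<open>z\<close> to be full as well, so there are exactly
      \<open>c + 1\<close> full vertices and the complete graph on them is a realization.\<close>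
    have "c dvd f z" using base sum by (metis dvd_add_left_iff dvd_triv_left)
    then have fz: "f z = c" using le[OF z(1)] z(2) by (simp add: dvd_imp_le le_antisym)
    then have q: "q = c" using base sum c by (metis Suc_eq_plus1 add_left_cancel mult_Suc_right nat_mult_eq_cancel1)
    have "{v \<in> V. f v = c} = insert z {v \<in> V. v \<noteq> z \<and> f v = c}" using z fz by auto
    then have "card {v \<in> V. f v = c} = c + 1" using V q by (simp add: q_def)
    then show ?thesis using others fz V
      by (intro realizes_complete[of V "{v \<in> V. f v = c}" c f]) auto
  next
    case step
    \<comment> \<open>With \<open>q \<le> c\<close> the sum would be at most
      \<open>c + c * c\<close>. This supplies the full vertices for the pigeonhole argument.\<close>
    have cq: "c < q"
    proof (rule ccontr)
      assume "\<not> c < q"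
      then have "c * q \<le> c * c" by simp
      then have "sum f V \<le> c * (c + 1)" using sum le[OF z(1)] unfolding distrib_left by linarith
      then show False using step by linarith
    qed
    show ?thesis
    proof (cases "2 \<le> f z")
      case True
      let ?g = "f(z := f z - 2)"
      have sg: "sum ?g V + 2 = sum f V"
        using sum_fun_upd[OF V z(1), of f "f z - 2"] True by simp
      have ext_g: "extremal V c ?g"
      proof (rule extremalI[of _ _ _ z])
        show "?g v \<le> c" if "v \<in> V" for v using le[OF that] le[OF z(1)] by auto
        show "?g v = 0 \<or> ?g v = c" if "v \<in> V" "v \<noteq> z" for v using others[of v] that by auto
      qed
      have even_g: "even (sum ?g V)" using sg less.prems(2) by (metis even_add even_numeral)
      have "sum ?g V < sum f V" "c * (c + 1) \<le> sum ?g V" using sg step by linarith+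
      then obtain E where E: "realizes V ?g E" using less.hyps[OF _ ext_g even_g] by blast
      have "{v \<in> V. v \<noteq> z \<and> ?g v = c} = {v \<in> V. v \<noteq> z \<and> f v = c}" by auto
      then have many: "c < card {v \<in> V. v \<noteq> z \<and> ?g v = c}" using cq by (simp only: q_def)
      have gz: "?g z < c" using le[OF z(1)] True by simp
      have "?g(z := ?g z + 2) = f" using True by (auto simp: fun_eq_iff)
      then show ?thesis using realizes_raise_vertex[OF E z(1) gz many] by (simp only:)
    next
      case False
      with z have fz: "f z = 1" by simp
      have "{v \<in> V. v \<noteq> z \<and> f v = c} \<noteq> {}" using cq by (metis card.empty not_less0 q_def)
      then obtain y where y: "y \<in> V" "y \<noteq> z" "f y = c" by auto
      \<comment> \<open>Here \<open>c * q\<close> is the sum minus 1, hence exceeds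
        \<open>c * (c + 1)\<close>. The spare full vertex pays for \<open>y\<close>, which stops
        being full.\<close>
      have cq': "c + 1 < q"
      proof (rule ccontr)
        assume "\<not> c + 1 < q"
        then have "c * q \<le> c * (c + 1)" by (intro mult_le_mono2) simp
        then show False using step sum fz by linarith
      qed
      \<comment> \<open>As \<open>z\<close> has only one unit, the second is taken from the full
        vertex \<open>y\<close>, which takes over as the exceptional vertex.\<close>
      let ?h = "f(z := 0)" let ?g = "?h(y := c - 1)"
      have sg: "sum ?g V + 2 = sum f V"
        using sum_fun_upd[OF V z(1), of f 0] sum_fun_upd[OF V y(1), of ?h "c - 1"] y c fz
        by simp
      have ext_g: "extremal V c ?g"
      proof (rule extremalI[of _ _ _ y])
        show "?g v \<le> c" if "v \<in> V" for v using le[OF that] le[OF z(1)] by auto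
        show "?g v = 0 \<or> ?g v = c" if "v \<in> V" "v \<noteq> y" for v using others[of v] that by auto
      qed
      have even_g: "even (sum ?g V)" using sg less.prems(2) by (metis even_add even_numeral)
      have "sum ?g V < sum f V" "c * (c + 1) \<le> sum ?g V" using sg step by linarith+
      then obtain E where E: "realizes V ?g E" using less.hyps[OF _ ext_g even_g] by blast
      have "{v \<in> V. v \<noteq> y \<and> ?g v = c} = {v \<in> V. v \<noteq> z \<and> f v = c} - {y}"
        using c by auto
      then have many: "c < card {v \<in> V. v \<noteq> y \<and> ?g v = c}"
        using cq' y V by (simp add: q_def card_Diff_singleton_if)
      have gyz: "?g y < c" "z \<noteq> y" "?g z = 0" using y c by simp_all
      have "?g(y := ?g y + 1, z := 1) = f" using y c fz by (auto simp: fun_eq_iff)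
      then show ?thesis
        using realizes_raise_two[OF E y(1) gyz(1) z(1) gyz(2,3) many] by (simp only:)
    qed
  qed
qed

section \<open>Reduction to the extremal case\<close>

text \<open>Making two intermediate entries more unequal raises the sum of squares, which is at most
  \<open>card V * c\<^sup>2\<close>. The induction realizes the less balanced function, and a unit
  transfer undoes the move.\<close>

lemma realizes_if_sum_ge:
  assumes V: "finite V" and c: "0 < c"
  shows "(\<And>v. v \<in> V \<Longrightarrow> f v \<le> c) \<Longrightarrow> even (sum f V) \<Longrightarrow> c * (c + 1) \<le> sum f V \<Longrightarrow>
    \<exists>E. realizes V f E"
proof (induction "card V * c\<^sup>2 - (\<Sum>v\<in>V. (f v)\<^sup>2)" arbitrary: f rule: less_induct)
  case less
  show ?case
  proof (cases "extremal V c f")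
    case True
    then show ?thesis using realizes_extremal[OF V c] less.prems by blast
  next
    case False
    then obtain i j where ij: "i \<in> V" "j \<in> V" "i \<noteq> j" "f i < c" "0 < f j" "f j \<le> f i"
      using less.prems(1) unfolding extremal_def by (metis nat_le_linear)
    let ?h = "f(j := f j - 1)" let ?g = "?h(i := f i + 1)"
    have sum: "sum ?g V = sum f V"
      using sum_fun_upd[OF V ij(2), of f "f j - 1"] sum_fun_upd[OF V ij(1), of ?h "f i + 1"] ij
      by simp
    have g: "?g v \<le> c" if "v \<in> V" for v using less.prems(1)[OF that] ij by auto
    \<comment> \<open>The gain is \<open>2 * (f i - f j) + 2\<close>, positive because
      \<open>f j \<le> f i\<close>.\<close>
    have sq: "(\<Sum>v\<in>V. (?g v)\<^sup>2) > (\<Sum>v\<in>V. (f v)\<^sup>2)"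
    proof -
      let ?R = "V - {i} - {j}"
      have "(\<Sum>v\<in>?R. (?g v)\<^sup>2) = (\<Sum>v\<in>?R. (f v)\<^sup>2)" by (intro sum.cong) auto
      moreover have split: "(\<Sum>v\<in>V. (k v)\<^sup>2) = (k i)\<^sup>2 + ((k j)\<^sup>2 + (\<Sum>v\<in>?R. (k v)\<^sup>2))"
        for k :: "'a \<Rightarrow> nat"
        using V ij sum.remove[of V i "\<lambda>v. (k v)\<^sup>2"] sum.remove[of "V - {i}" j "\<lambda>v. (k v)\<^sup>2"]
        by simp
      moreover obtain m where "f j = Suc m" using ij(5) by (metis gr0_implies_Suc)
      ultimately show ?thesis
        using ij split[of f] split[of ?g] by (simp add: power2_eq_square)
    qed
    \<comment> \<open>Without this bound the truncated difference used as the measure might not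
      decrease.\<close>
    have "(\<Sum>v\<in>V. (?g v)\<^sup>2) \<le> card V * c\<^sup>2"
      using sum_bounded_above[of V "\<lambda>v. (?g v)\<^sup>2" "c\<^sup>2"] g by (simp add: power_mono)
    then have "card V * c\<^sup>2 - (\<Sum>v\<in>V. (?g v)\<^sup>2) < card V * c\<^sup>2 - (\<Sum>v\<in>V. (f v)\<^sup>2)"
      using sq by linarith
    moreover have "even (sum ?g V)" "c * (c + 1) \<le> sum ?g V" using less.prems(2,3) sum by metis+
    ultimately obtain E where E: "realizes V ?g E" using less.hyps[of ?g, OF _ g] by blast
    have "?g j < ?g i" using ij by auto
    then have "\<exists>E'. realizes V (?g(i := ?g i - 1, j := ?g j + 1)) E'"
      by (rule realizes_unit_transfer[OF E ij(1,2)])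
    moreover have "?g(i := ?g i - 1, j := ?g j + 1) = f" using ij by (auto simp: fun_eq_iff)
    ultimately show ?thesis by (simp only:)
  qed
qed

section \<open>Degree sequences and the region\<close>

lemma graphic_if_sum_ge:
  assumes c: "0 < c" and d: "\<And>x. x \<in> set d \<Longrightarrow> 0 \<le> x \<and> x \<le> int c"
    and even: "even (sum_list d)" and ge: "int (c * (c + 1)) \<le> sum_list d"
  shows "graphic d"
proof -
  let ?f = "\<lambda>i. nat (d ! i)"
  have f: "int (?f i) = d ! i" "?f i \<le> c" if "i < length d" for i
    using d[OF nth_mem[OF that]] by auto
  have "sum_list d = (\<Sum>i<length d. int (?f i))"
    unfolding sum_list_sum_nth atLeast0LessThan by (intro sum.cong refl) (simp only: lessThan_iff f)
  then have sum: "sum_list d = int (sum ?f {..<length d})" by simp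
  have "\<exists>E. realizes {..<length d} ?f E"
    using realizes_if_sum_ge[OF _ c, of "{..<length d}" ?f] f(2) even ge unfolding sum
    by (metis finite_lessThan lessThan_iff even_of_nat of_nat_le_iff)
  then show ?thesis unfolding graphic_def realizes_def using f(1) by force
qed

text \<open>The root bound gives \<open>c\<^sup>2 + \<epsilon> * S \<le> S\<close>, so
  \<open>c \<le> \<epsilon> * S\<close> suffices; it follows from
  \<open>c\<^sup>2 \<le> S \<le> (\<epsilon> * S)\<^sup>2\<close>.\<close>

lemma square_plus_self_le:
  fixes \<epsilon> :: real and c S :: nat
  assumes "\<epsilon> > 0" "0 < c" "real c \<le> sqrt ((1 - \<epsilon>) * real S)" "1 / \<epsilon>\<^sup>2 \<le> real S"
  shows "c * (c + 1) \<le> S"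
proof -
  \<comment> \<open>Squaring the bound needs a positive radicand, since \<open>sqrt\<close> of a
    negative number is negative rather than undefined.\<close>
  have "0 < sqrt ((1 - \<epsilon>) * real S)" using assms(2,3) by linarith
  then have "(real c)\<^sup>2 \<le> (1 - \<epsilon>) * real S"
    using assms(3) by (metis of_nat_0_le_iff power_mono real_sqrt_gt_0_iff real_sqrt_pow2 less_imp_le)
  then have sq: "(real c)\<^sup>2 + \<epsilon> * real S \<le> real S" by (simp add: algebra_simps)
  have "real S \<le> (\<epsilon> * real S)\<^sup>2"
  proof -
    have "1 \<le> \<epsilon>\<^sup>2 * real S" using assms(1,4) by (simp add: field_simps)
    then have "1 * real S \<le> \<epsilon>\<^sup>2 * real S * real S" by (intro mult_right_mono) auto
    then show ?thesis by (simp add: power2_eq_square algebra_simps)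
  qed
  moreover have "0 \<le> \<epsilon> * real S" using assms(1) by simp
  ultimately have "real c \<le> \<epsilon> * real S"
    using sq by (intro power2_le_imp_le[of "real c"]) linarith+
  then have "real (c * (c + 1)) \<le> real S" using sq by (simp add: power2_eq_square algebra_simps)
  then show ?thesis by (simp only: of_nat_le_iff)
qed

theorem theorem3p4:
  fixes \<epsilon> :: real
  assumes "\<epsilon> > 0"
  shows "almost_fully_graphic (simple_region (phi \<epsilon>))"
proof -
  \<comment> \<open>\<open>K\<close> is the threshold of \<open>square_plus_self_le\<close>;
    \<open>F\<close> is a finite box that catches every sequence of the region with sum at most
    \<open>K\<close>.\<close>
  define K where "K = nat \<lceil>1 / \<epsilon>\<^sup>2\<rceil>"
  define F where "F = {d :: int list. set d \<subseteq> {0..int K} \<and> length d \<le> K}"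
  have "finite F" unfolding F_def by (intro finite_lists_length_le) simp
  moreover have "graphic d" if d: "d \<in> simple_region (phi \<epsilon>) - F" for d
  proof -
    from d obtain n S c1 c2 where mem: "d \<in> degree_seqs n S c1 c2" and phi: "phi \<epsilon> n S c1 c2"
      unfolding simple_region_def by blast
    have ent: "2 \<le> x \<and> x \<le> int c1" if "x \<in> set d" for x
      using mem phi that by (force simp: degree_seqs_def phi_def)
    have sum: "even (sum_list d)" "sum_list d = int S" using mem by (auto simp: degree_seqs_def)
    have "K < S"
    proof (rule ccontr)
      assume "\<not> K < S"
      then have SK: "sum_list d \<le> int K" using sum by simp
      \<comment> \<open>As all entries are positive, the sum bounds each entry and also the
        length.\<close>
      have "x \<le> sum_list d" if "x \<in> set d" for x
        using that ent by (intro member_le_sum_list) force+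
      moreover have "int (length d) \<le> sum_list d"
        using sum_list_mono[of d "\<lambda>_. 1" "\<lambda>x. x"] ent by (force simp: sum_list_triv)
      ultimately have "d \<in> F" using SK ent by (force simp: F_def)
      with d show False by simp
    qed
    then have "1 / \<epsilon>\<^sup>2 \<le> real S" unfolding K_def by linarith
    then have "c1 * (c1 + 1) \<le> S"
      using phi assms by (intro square_plus_self_le) (auto simp: phi_def)
    then have "int (c1 * (c1 + 1)) \<le> sum_list d" unfolding sum(2) of_nat_le_iff .
    moreover have "0 < c1" using phi by (simp add: phi_def)
    ultimately show ?thesis using ent sum by (intro graphic_if_sum_ge[of c1]) force+
  qed
  ultimately show ?thesis unfolding almost_fully_graphic_def fully_graphic_def by blast
qed

end
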